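(* For every $r,\Delta \in \mathbb{Z}_{>0}$ with $r \geq 3$, we have \[ g(\Delta,r) \leq 130\, r^3 \Delta^{\frac{2}{r}}. \]
   Context: A matrix $A \in \mathbb{Z}^{r \times n}$ is called generic if all its $\operatorname{rank}(A) \times \operatorname{rank}(A)$ minors are non-zero. It is called $\Delta$-modular if all its $\operatorname{rank}(A) \times \operatorname{rank}(A)$ minors are bounded by $\Delta$ in absolute value and at least one such minor equals $\Delta$ or $-\Delta$. Matrices are assumed to have no repeated columns. Define \[ g(\Delta,r) := \max\{ n : \exists \text{ a generic } \Delta\text{-modular } A \in \mathbb{Z}^{r \times n} \text{ with } \operatorname{rank}(A) = r\}. \] *)

theory Defs
  imports Complex_Main "HOL-Library.FuncSet" "Jordan_Normal_Form.DL_Rank_Submatrix"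
begin

text \<open>The rank of an integer matrix is its rank over the rationals; the first argument of
  \<open>vec_space.rank\<close> is the dimension of the column vectors.\<close>

definition int_rank :: "int mat \<Rightarrow> nat" where
  "int_rank A = vec_space.rank (dim_row A) (map_mat rat_of_int A)"

definition minors :: "nat \<Rightarrow> int mat \<Rightarrow> int set" where
  "minors k A = {det (submatrix A I J) | I J.
     I \<subseteq> {..<dim_row A} \<and> J \<subseteq> {..<dim_col A} \<and> card I = k \<and> card J = k}"

definition generic_mat :: "int mat \<Rightarrow> bool" where
  "generic_mat A \<longleftrightarrow> (\<forall>d \<in> minors (int_rank A) A. d \<noteq> 0)"

definition modular_mat :: "nat \<Rightarrow> int mat \<Rightarrow> bool" where
  "modular_mat \<Delta> A \<longleftrightarrow>
     (\<forall>d \<in> minors (int_rank A) A. \<bar>d\<bar> \<le> int \<Delta>) \<and>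
     (\<exists>d \<in> minors (int_rank A) A. d = int \<Delta> \<or> d = - int \<Delta>)"

definition generic_sizes :: "nat \<Rightarrow> nat \<Rightarrow> nat set" where
  "generic_sizes \<Delta> r = {n. \<exists>A \<in> carrier_mat r n.
     distinct (cols A) \<and> generic_mat A \<and> modular_mat \<Delta> A \<and> int_rank A = r}"

definition g :: "nat \<Rightarrow> nat \<Rightarrow> nat" where
  "g \<Delta> r = Max (generic_sizes \<Delta> r)"

text \<open>\<open>Max\<close> is only meaningful on finite nonempty sets, so the remaining facts establish
  that the maximum defining \<open>g \<Delta> r\<close> exists for positive \<open>\<Delta>\<close> and \<open>r\<close>.\<close>

lemma submatrix_full:
  assumes "A \<in> carrier_mat m n"
  shows "submatrix A {..<m} {..<n} = A"
proof -
  have p: "pick {..<k} i = i" if "i < k" for i k :: nat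
  proof -
    have "{a \<in> {..<k}. a < i} = {..<i}" using that by auto
    then show ?thesis using pick_card_in_set[of i "{..<k}"] that by simp
  qed
  have s: "{i. i < k \<and> i \<in> {..<k}} = {..<k}" for k :: nat by auto
  show ?thesis using assms
    by (intro eq_matI) (auto simp: submatrix_def s p)
qed

lemma minors_square:
  assumes "A \<in> carrier_mat r r"
  shows "minors r A = {det A}"
proof -
  have eq: "I \<subseteq> {..<r} \<and> card I = r \<longleftrightarrow> I = {..<r}" for I :: "nat set"
    using card_subset_eq[of "{..<r}" I] by auto
  have "minors r A = {det (submatrix A I J) | I J. I = {..<r} \<and> J = {..<r}}"
    unfolding minors_def eq[symmetric] using assms by (intro Collect_cong) auto
  then show ?thesis using submatrix_full[OF assms] by simp
qed

lemma generic_sizes_nonempty: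
  assumes "\<Delta> > 0" "r > 0"
  shows "generic_sizes \<Delta> r \<noteq> {}"
proof -
  interpret vec_space "TYPE(rat)" r .
  define A where "A = mat r r (\<lambda>(i,j). if i = j then (if i = 0 then int \<Delta> else 1) else 0)"
  have A: "A \<in> carrier_mat r r" by (simp add: A_def)
  have "det A = prod_list (diag_mat A)"
    by (rule det_upper_triangular[OF _ A]) (auto simp: A_def)
  also have "\<dots> = (\<Prod>i<r. if i = 0 then int \<Delta> else 1)"
    by (simp add: prod_list_diag_prod A_def atLeast0LessThan)
  also have "\<dots> = int \<Delta>" using assms by simp
  finally have d: "det A = int \<Delta>" .
  let ?B = "map_mat rat_of_int A"
  have B: "?B \<in> carrier_mat r r" using A by simp
  have "det ?B \<noteq> 0" using d assms by simp
  then have rk: "rank ?B = r" using det_rank_iff[OF B] by simp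
  then have "distinct (cols ?B)" using non_distinct_low_rank[OF B] by auto
  moreover have "cols ?B = map (map_vec rat_of_int) (cols A)"
    by (auto simp: cols_def)
  ultimately have "distinct (cols A)" by (simp add: distinct_map)
  moreover have "int_rank A = r" using rk A by (simp add: int_rank_def)
  ultimately have "r \<in> generic_sizes \<Delta> r"
    using A d assms minors_square[OF A]
    by (auto simp: generic_sizes_def generic_mat_def modular_mat_def intro!: bexI[of _ A])
  then show ?thesis by auto
qed

lemma dvd_det_of_cong_columns:
  fixes B :: "int mat"
  assumes B: "B \<in> carrier_mat r r" and pq: "p < r" "q < r" "p \<noteq> q"
    and c: "\<And>i. i < r \<Longrightarrow> m dvd B $$ (i,p) - B $$ (i,q)"
  shows "m dvd det B"
proof -
  let ?C = "addcol (-1) p q B"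
  have C: "?C \<in> carrier_mat r r" using B by (intro carrier_matI) auto
  have "det ?C = (\<Sum>i<r. ?C $$ (i,p) * cofactor ?C i p)"
    by (rule laplace_expansion_column[OF C pq(1)])
  moreover have "m dvd ?C $$ (i,p)" if "i < r" for i
    using c[OF that] B pq that by (simp add: algebra_simps)
  ultimately have "m dvd det ?C" by (auto intro!: dvd_sum)
  then show ?thesis using det_addcol[OF pq(2) pq(3) B, of "-1"] by simp
qed

lemma generic_sizes_finite:
  assumes "r > 0"
  shows "finite (generic_sizes \<Delta> r)"
proof -
  interpret vec_space "TYPE(rat)" r .
  define m where "m = 2 * int \<Delta> + 1"
  let ?T = "{..<r} \<rightarrow>\<^sub>E {0..<m}"
  have fT: "finite ?T" by (intro finite_PiE) auto
  have "n \<le> card ?T" if n: "n \<in> generic_sizes \<Delta> r" for n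
  proof -
    obtain A where A: "A \<in> carrier_mat r n" and dist: "distinct (cols A)"
      and gen: "generic_mat A" and md: "modular_mat \<Delta> A" and rk: "int_rank A = r"
      using n by (auto simp: generic_sizes_def)
    have "map_mat rat_of_int A \<in> carrier_mat r n" using A by simp
    from rank_le_nc[OF this] have rn: "r \<le> n" using rk A by (simp add: int_rank_def)
    define h where "h j = (\<lambda>i\<in>{..<r}. A $$ (i,j) mod m)" for j
    have min: "det (submatrix A {..<r} J) \<noteq> 0 \<and> \<bar>det (submatrix A {..<r} J)\<bar> < m"
      if "J \<subseteq> {..<n}" "card J = r" for J
    proof -
      have "det (submatrix A {..<r} J) \<in> minors r A"
        using A that unfolding minors_def by force
      then show ?thesis using gen md unfolding generic_mat_def modular_mat_def rk m_def by force
    qed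
    have "inj_on h {..<n}"
    proof (rule inj_onI, rule ccontr)
      fix j k assume jk: "j \<in> {..<n}" "k \<in> {..<n}" "h j = h k" "j \<noteq> k"
      have dv: "m dvd A $$ (i,j) - A $$ (i,k)" if "i < r" for i
        using fun_cong[OF jk(3), of i] that by (simp add: h_def mod_eq_dvd_iff)
      have r: "{i. i < r \<and> i \<in> {..<r}} = {..<r}" by auto
      have pick_r: "pick {..<r} i = i" if "i < r" for i
      proof -
        have "{a \<in> {..<r}. a < i} = {..<i}" using that by auto
        then show ?thesis using pick_card_in_set[of i "{..<r}"] that by simp
      qed
      show False
      proof (cases "r = 1")
        case True
        have e: "\<bar>A $$ (0,l)\<bar> \<le> int \<Delta>" if "l < n" for l
        proof -
          have S: "{a. a < n \<and> a \<in> {l}} = {l}" using that by auto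
          have "pick {l} 0 = l" using pick_in_set_le[of 0 "{l}"] by simp
          then have "submatrix A {..<r} {l} = mat 1 1 (\<lambda>_. A $$ (0,l))"
            using A True S r pick_r by (intro eq_matI) (auto simp: submatrix_def)
          then have dt: "det (submatrix A {..<r} {l}) = A $$ (0,l)"
            by (simp add: det_single)
          have "det (submatrix A {..<r} {l}) \<in> minors r A"
            using A True that unfolding minors_def by force
          then show ?thesis using md dt unfolding modular_mat_def rk by auto
        qed
        have "A $$ (0,j) = A $$ (0,k)"
        proof (rule ccontr)
          assume "\<not> ?thesis"
          then have "m \<le> \<bar>A $$ (0,j) - A $$ (0,k)\<bar>"
            using dvd_imp_le_int[OF _ dv[of 0]] True by (auto simp: m_def)
          then show False using e[of j] e[of k] jk unfolding m_def by auto
        qed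
        then have "col A j = col A k" using A True jk by (intro eq_vecI) auto
        then show False using dist jk A nth_eq_iff_index_eq[OF dist, of j k] by auto
      next
        case False
        then have "2 \<le> r" using assms by simp
        moreover have "{j,k} \<subseteq> {..<n}" "card {j,k} = 2" using jk by auto
        ultimately obtain J where J: "{j,k} \<subseteq> J" "J \<subseteq> {..<n}" "card J = r"
          using exists_subset_between[of "{j,k}" r "{..<n}"] rn by auto
        let ?B = "submatrix A {..<r} J"
        have S: "{a. a < n \<and> a \<in> J} = J" using J by auto
        have B: "?B \<in> carrier_mat r r" using A J S r by (auto simp: submatrix_def)
        have fJ: "finite J" using J finite_subset by blast
        let ?p = "\<lambda>l. card {a \<in> J. a < l}"
        have lt: "?p l < r" if "l \<in> J" for l
          using that fJ J(3) by (metis (no_types, lifting) less_irrefl mem_Collect_eq psubsetI psubset_card_mono subsetI)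
        have pk: "pick J (?p l) = l" if "l \<in> J" for l
          using pick_card_in_set that by simp
        have en: "?B $$ (i, ?p l) = A $$ (i,l)" if "i < r" "l \<in> J" for i l
          using A that S r lt[OF that(2)] pk[OF that(2)] pick_r J(3) by (simp add: submatrix_def)
        have "?p j \<noteq> ?p k" using pk J(1) jk(4) by (metis insert_subset)
        then have "m dvd det ?B"
          using J(1) en dv lt by (intro dvd_det_of_cong_columns[OF B, of "?p j" "?p k"]) auto
        then show False using min[OF J(2,3)] dvd_imp_le_int[of "det ?B" m] by linarith
      qed
    qed
    moreover have "h ` {..<n} \<subseteq> ?T"
    proof -
      have "m > 0" by (simp add: m_def)
      then show ?thesis by (auto simp: h_def split: if_splits)
    qed
    ultimately show ?thesis using card_inj_on_le[of h "{..<n}" ?T, OF _ _ fT] by simp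
  qed
  then show ?thesis by (meson finite_nat_set_iff_bounded_le)
qed

end

theory Submission
  imports Defs
begin

text \<open>
  Let \<open>B\<close> be a basis of columns with \<open>\<bar>det B\<bar> = \<Delta>\<close>. By Cramer's rule every column \<open>x\<close> of the matrix
  is \<open>B \<lambda>\<close> with \<open>\<lambda> \<in> [-1,1]\<^sup>r\<close>. The lattice \<open>L = B\<^sup>T \<int>\<^sup>r\<close> has index \<open>\<Delta>\<close>, so some coset of \<open>L\<close> meets
  the box \<open>{0..T}\<^sup>r\<close> in a set \<open>S\<close> with at least \<open>(T+1)\<^sup>r / \<Delta>\<close> points. For two points of \<open>S\<close>, write
  \<open>z - z' = B\<^sup>T y\<close> with \<open>y\<close> integral; then \<open>\<lambda> \<bullet> z - \<lambda> \<bullet> z' = x \<bullet> y\<close> is an integer, so \<open>\<lambda>\<close> takes at most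
  \<open>r T + 1\<close> values on \<open>S\<close>, and by Cauchy-Schwarz every column has many pairs of points in \<open>S\<close> on
  which its values coincide. By genericity fewer than \<open>r\<close> columns are orthogonal to a given \<open>y \<noteq> 0\<close>.
  Counting coincidences in two ways bounds the number of columns by \<open>2 r (r T + 1)\<close> as soon as
  \<open>S\<close> has \<open>2 (r T + 1)\<close> points, which already happens for \<open>T\<close> of order \<open>r \<Delta>\<^bsup>1/(r-1)\<^esup>\<close>; since \<open>1/(r-1) \<le> 2/r\<close>,
  the choice \<open>T = \<lfloor>2 r \<Delta>\<^bsup>2/r\<^esup>\<rfloor>\<close> suffices.
\<close>

section \<open>Coset representatives of an integer lattice\<close>

lemma smult_one_mult_mat_vec:
  fixes x :: "'a :: comm_ring_1 vec"
  assumes x: "x \<in> carrier_vec n"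
  shows "(c \<cdot>\<^sub>m 1\<^sub>m n) *\<^sub>v x = c \<cdot>\<^sub>v x"
proof (rule eq_vecI)
  fix i assume "i < dim_vec (c \<cdot>\<^sub>v x)"
  then have i: "i < n" using x by simp
  have "row (c \<cdot>\<^sub>m 1\<^sub>m n) i = c \<cdot>\<^sub>v unit_vec n i" using i by (intro eq_vecI) auto
  then show "((c \<cdot>\<^sub>m 1\<^sub>m n) *\<^sub>v x) $ i = (c \<cdot>\<^sub>v x) $ i" using i x by simp
qed (use x in simp)

text \<open>A triangular basis of the column lattice of \<open>M\<close> lets coordinates be reduced
  one at a time into the box given by its diagonal, and its determinant divides
  \<open>det M\<close>. This serves to bound the number of cosets of the lattice by
  \<open>\<bar>det M\<bar>\<close>.\<close>

lemma det_lattice_reduction: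
  fixes M :: "int mat"
  assumes M: "M \<in> carrier_mat r r" and d: "det M \<noteq> 0"
  obtains g :: "nat \<Rightarrow> nat"
  where "int (\<Prod>k<r. g k) \<le> \<bar>det M\<bar>"
    and "\<And>z. z \<in> carrier_vec r \<Longrightarrow>
      \<exists>y\<in>carrier_vec r. \<forall>k<r. (z - M *\<^sub>v y) $ k \<in> {0..<int (g k)}"
proof -
  define L where "L = (\<lambda>y. M *\<^sub>v y) ` carrier_vec r"
  have L_carrier: "z \<in> carrier_vec r" if "z \<in> L" for z using that M by (auto simp: L_def)
  \<comment> \<open>The minimal leading entries \<open>g k\<close> give a lower triangular basis \<open>V\<close> of \<open>L\<close> with diagonal \<open>g\<close>.\<close>
  define D where "D k m \<longleftrightarrow> m > 0 \<and> (\<exists>z\<in>L. (\<forall>i<k. z $ i = 0) \<and> z $ k = int m)" for k m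
  define g where "g k = (LEAST m. D k m)" for k
  have "D k (g k)" if k: "k < r" for k
  proof -
    \<comment> \<open>The adjugate yields the lattice vector
      \<open>\<bar>det M\<bar> \<cdot>\<^sub>v unit_vec r k\<close>, so the minimum defining
      \<open>g k\<close> exists; the factor \<open>sgn (det M)\<close> makes the leading entry
      positive.\<close>
    define a where "a = sgn (det M) \<cdot>\<^sub>v (adj_mat M *\<^sub>v unit_vec r k)"
    have a: "a \<in> carrier_vec r" using adj_mat(1)[OF M] by (simp add: a_def)
    have "M *\<^sub>v a = sgn (det M) \<cdot>\<^sub>v (M *\<^sub>v (adj_mat M *\<^sub>v unit_vec r k))"
      unfolding a_def using M adj_mat(1)[OF M] by (auto intro!: eq_vecI)
    also have "M *\<^sub>v (adj_mat M *\<^sub>v unit_vec r k) = (M * adj_mat M) *\<^sub>v unit_vec r k"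
      using M adj_mat(1)[OF M] by simp
    also have "\<dots> = det M \<cdot>\<^sub>v unit_vec r k" unfolding adj_mat(2)[OF M] by (auto intro!: eq_vecI)
    finally have e: "M *\<^sub>v a = \<bar>det M\<bar> \<cdot>\<^sub>v unit_vec r k"
      by (simp add: smult_smult_assoc abs_sgn mult.commute)
    have "D k (nat \<bar>det M\<bar>)" unfolding D_def
    proof (intro conjI bexI[of _ "M *\<^sub>v a"])
      show "M *\<^sub>v a \<in> L" using a by (auto simp: L_def)
    qed (use d k e in auto)
    then show ?thesis unfolding g_def by (rule LeastI)
  qed
  then have g: "g k > 0" and "\<exists>y\<in>carrier_vec r. (\<forall>i<k. (M *\<^sub>v y) $ i = 0) \<and> (M *\<^sub>v y) $ k = int (g k)"
    if "k < r" for k using that by (auto simp: D_def L_def)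
  then obtain y where y: "\<And>k. k < r \<Longrightarrow> y k \<in> carrier_vec r"
    "\<And>k i. k < r \<Longrightarrow> i < k \<Longrightarrow> (M *\<^sub>v y k) $ i = 0" "\<And>k. k < r \<Longrightarrow> (M *\<^sub>v y k) $ k = int (g k)"
    by metis
  define Y where "Y = mat r r (\<lambda>(i,k). y k $ i)"
  define V where "V = M * Y"
  have Y: "Y \<in> carrier_mat r r" and V: "V \<in> carrier_mat r r" using M by (auto simp: Y_def V_def)
  have "col Y k = y k" if "k < r" for k using y(1)[OF that] that by (auto simp: Y_def)
  then have V_entry: "V $$ (i,k) = (M *\<^sub>v y k) $ i" if "i < r" "k < r" for i k
    using that M Y by (simp add: V_def)
  have V_lower: "V $$ (i,k) = 0" if "i < k" "k < r" for i k using that V_entry y(2) by simp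
  have V_diag: "V $$ (k,k) = int (g k)" if "k < r" for k using that V_entry y(3) by simp
  have det_V: "det V = int (\<Prod>k<r. g k)"
    using det_lower_triangular[OF V_lower V] V V_diag
    by (simp add: prod_list_diag_prod atLeast0LessThan)
  have reduce: "\<exists>c\<in>carrier_vec r. \<forall>k<m. (z - V *\<^sub>v c) $ k \<in> {0..<int (g k)}"
    if z: "z \<in> carrier_vec r" and "m \<le> r" for z m
    using \<open>m \<le> r\<close>
  proof (induction m)
    case 0
    have "0\<^sub>v r \<in> carrier_vec r" by simp
    then show ?case by blast
  next
    case (Suc m)
    then obtain c where c: "c \<in> carrier_vec r" "\<forall>k<m. (z - V *\<^sub>v c) $ k \<in> {0..<int (g k)}" by auto
    have m: "m < r" using Suc by simp
    \<comment> \<open>Subtracting \<open>q\<close> times column \<open>m\<close> of \<open>V\<close>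
      reduces coordinate \<open>m\<close> modulo \<open>g m\<close>; earlier coordinates stay
      unchanged because \<open>V\<close> is lower triangular.\<close>
    define q where "q = (z - V *\<^sub>v c) $ m div int (g m)"
    define c' where "c' = c + q \<cdot>\<^sub>v unit_vec r m"
    have "V *\<^sub>v c' = V *\<^sub>v c + q \<cdot>\<^sub>v (V *\<^sub>v unit_vec r m)"
      unfolding c'_def using V c(1) m by (auto intro!: eq_vecI simp: scalar_prod_add_distrib[of _ r])
    also have "V *\<^sub>v unit_vec r m = col V m" using V m by (auto intro!: eq_vecI)
    finally have e: "(z - V *\<^sub>v c') $ k = (z - V *\<^sub>v c) $ k - q * V $$ (k,m)" if "k < r" for k
      using that m z V c(1) by simp
    have "(z - V *\<^sub>v c') $ k \<in> {0..<int (g k)}" if "k < Suc m" for k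
    proof (cases "k = m")
      case True
      have "(z - V *\<^sub>v c') $ m = (z - V *\<^sub>v c) $ m mod int (g m)"
        using e[OF m] V_diag[OF m] by (simp add: q_def minus_div_mult_eq_mod)
      then show ?thesis using True g[OF m] by simp
    next
      case False
      then show ?thesis using that c(2) e[of k] V_lower[of k m] m by auto
    qed
    moreover have "c' \<in> carrier_vec r" using c(1) by (simp add: c'_def)
    ultimately show ?case by blast
  qed
  have VL: "V *\<^sub>v c = M *\<^sub>v (Y *\<^sub>v c)" if "c \<in> carrier_vec r" for c
    using that M Y by (simp add: V_def)
  \<comment> \<open>\<open>V\<close> spans all of \<open>L\<close>: the remainder of a lattice
    vector is again in \<open>L\<close>, and its first nonzero coordinate would be a positive
    leading entry below the minimal one.\<close>
  have "\<exists>c\<in>carrier_vec r. z = V *\<^sub>v c" if "z \<in> L" for z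
  proof -
    have z: "z \<in> carrier_vec r" using that by (rule L_carrier)
    obtain c where c: "c \<in> carrier_vec r" "\<forall>k<r. (z - V *\<^sub>v c) $ k \<in> {0..<int (g k)}"
      using reduce[OF z order_refl] by auto
    obtain x where x: "x \<in> carrier_vec r" "z = M *\<^sub>v x" using \<open>z \<in> L\<close> by (auto simp: L_def)
    have "z - V *\<^sub>v c = M *\<^sub>v (x - Y *\<^sub>v c)"
      using VL[OF c(1)] x M Y c by (simp add: mult_minus_distrib_mat_vec)
    then have w: "z - V *\<^sub>v c \<in> L" using x Y c by (auto simp: L_def)
    have "(z - V *\<^sub>v c) $ k = 0" if "k < r" for k using that
    proof (induction k rule: less_induct)
      case (less k)
      show ?case
      proof (rule ccontr)
        assume nz: "\<not> ?case"
        define t where "t = (z - V *\<^sub>v c) $ k"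
        have t: "0 < t" "t < int (g k)"
          using c(2)[rule_format, OF less(2)] nz unfolding t_def[symmetric] by auto
        have "\<forall>i<k. (z - V *\<^sub>v c) $ i = 0" using less by simp
        then have "D k (nat t)" using t w unfolding D_def t_def[symmetric]
          by (intro conjI bexI[of _ "z - V *\<^sub>v c"]) (simp_all add: t_def)
        then have "g k \<le> nat t" unfolding g_def by (rule Least_le)
        then show False using t by linarith
      qed
    qed
    then have "z = V *\<^sub>v c" using z V c(1) by (intro eq_vecI) auto
    then show ?thesis using c(1) by auto
  qed
  moreover have "col M j \<in> L" if "j < r" for j
  proof -
    have "col M j = M *\<^sub>v unit_vec r j" using M that by (auto intro!: eq_vecI)
    then show ?thesis by (auto simp: L_def)
  qed
  ultimately have "\<forall>j\<in>{..<r}. \<exists>c. c \<in> carrier_vec r \<and> col M j = V *\<^sub>v c" by fast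
  from bchoice[OF this] obtain c where
    c: "\<And>j. j < r \<Longrightarrow> c j \<in> carrier_vec r" "\<And>j. j < r \<Longrightarrow> col M j = V *\<^sub>v c j"
    by blast
  \<comment> \<open>Integral coordinates of the columns of \<open>M\<close> in the basis
    \<open>V\<close> give \<open>M = V * C\<close>, so \<open>det V\<close> divides the nonzero
    \<open>det M\<close>.\<close>
  define C where "C = mat r r (\<lambda>(i,j). c j $ i)"
  have C: "C \<in> carrier_mat r r" by (simp add: C_def)
  have "col C j = c j" if "j < r" for j using c(1)[OF that] that by (auto simp: C_def)
  then have "col M j = col (V * C) j" if "j < r" for j
    using c(2)[OF that] that V C by (auto intro!: eq_vecI)
  then have "M = V * C" using M V C by (intro mat_col_eqI) auto
  then have "det M = det V * det C" using det_mult[OF V C] by simp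
  then have "int (\<Prod>k<r. g k) \<le> \<bar>det M\<bar>"
    using d det_V dvd_imp_le_int[of "det M" "det V"] by simp
  moreover have "\<exists>y\<in>carrier_vec r. \<forall>k<r. (z - M *\<^sub>v y) $ k \<in> {0..<int (g k)}"
    if "z \<in> carrier_vec r" for z
  proof -
    obtain c where c: "c \<in> carrier_vec r" "\<forall>k<r. (z - V *\<^sub>v c) $ k \<in> {0..<int (g k)}"
      using reduce[OF \<open>z \<in> carrier_vec r\<close> order_refl] by blast
    have "Y *\<^sub>v c \<in> carrier_vec r" using Y c(1) by simp
    then show ?thesis using c(2) unfolding VL[OF c(1)] by blast
  qed
  ultimately show thesis by (rule that)
qed

section \<open>Double counting of coincidences\<close>

text \<open>Count the triples \<open>j\<close>, \<open>z\<close>, \<open>z'\<close> with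
  \<open>f j z = f j z'\<close>. With \<open>s = card S\<close>, Cauchy-Schwarz gives at least
  \<open>s\<^sup>2 / m\<close> for each \<open>j\<close>, while pairs contribute at most
  \<open>q * s\<^sup>2\<close> off the diagonal and \<open>s * card J\<close> on it. Since
  \<open>s\<close> is at least \<open>2 * m\<close>, the diagonal is at most half of the lower
  bound.\<close>

lemma card_le_of_few_coincidences:
  fixes f :: "'j \<Rightarrow> 's \<Rightarrow> 'v"
  assumes S: "finite S" and J: "finite J"
    and vals: "\<And>j. j \<in> J \<Longrightarrow> card (f j ` S) \<le> m"
    and coin: "\<And>z z'. z \<in> S \<Longrightarrow> z' \<in> S \<Longrightarrow> z \<noteq> z' \<Longrightarrow> card {j\<in>J. f j z = f j z'} \<le> q"
    and m: "0 < m" "2 * m \<le> card S"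
  shows "card J \<le> 2 * q * m"
proof -
  define s where "s = card S"
  define E where "E j = card {p \<in> S \<times> S. f j (fst p) = f j (snd p)}" for j
  have lower: "s\<^sup>2 \<le> m * E j" if j: "j \<in> J" for j
  proof -
    define c where "c v = card {z\<in>S. f j z = v}" for v
    have "s = (\<Sum>v\<in>f j ` S. c v)"
      unfolding s_def c_def using S card_eq_sum sum.image_gen[of S "\<lambda>_. 1::nat" "f j"] by simp
    then have sum_c: "(\<Sum>v\<in>f j ` S. real (c v)) = real s" by (metis of_nat_sum)
    moreover have "(\<Sum>v\<in>f j ` S. (c v)\<^sup>2) = E j"
    proof -
      have "{p \<in> S \<times> S. f j (fst p) = f j (snd p)} =
          (\<Union>v\<in>f j ` S. {z\<in>S. f j z = v} \<times> {z\<in>S. f j z = v})" by auto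
      also have "card \<dots> = (\<Sum>v\<in>f j ` S. card ({z\<in>S. f j z = v} \<times> {z\<in>S. f j z = v}))"
        using S by (intro card_UN_disjoint) auto
      finally show ?thesis by (simp add: E_def c_def card_cartesian_product power2_eq_square)
    qed
    ultimately have sum_c2: "(\<Sum>v\<in>f j ` S. (real (c v))\<^sup>2) = real (E j)"
      by (simp flip: of_nat_sum of_nat_power)
    \<comment> \<open>Cauchy-Schwarz by expanding squares that vanish when \<open>m\<close> fibres
      all have size \<open>s / m\<close>; having fewer than \<open>m\<close> values only lowers the
      last term.\<close>
    have "0 \<le> (\<Sum>v\<in>f j ` S. (real m * real (c v) - real s)\<^sup>2)" by (intro sum_nonneg) simp
    also have "\<dots> = (real m)\<^sup>2 * real (E j) - 2 * real m * real s * real s + real (card (f j ` S)) * (real s)\<^sup>2"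
      by (simp add: power2_diff power_mult_distrib sum.distrib sum_subtractf mult.assoc
        sum_distrib_left[symmetric] sum_distrib_right[symmetric] sum_c sum_c2)
    also have "\<dots> \<le> (real m)\<^sup>2 * real (E j) - 2 * real m * real s * real s + real m * (real s)\<^sup>2"
      using vals[OF j] by (intro add_left_mono mult_right_mono) auto
    also have "\<dots> = real m * (real (m * E j) - real (s\<^sup>2))"
      by (simp add: power2_eq_square algebra_simps)
    finally have "real (s\<^sup>2) \<le> real (m * E j)" using m by (simp add: zero_le_mult_iff)
    then show ?thesis by linarith
  qed
  have "(\<Sum>j\<in>J. E j) = (\<Sum>j\<in>J. \<Sum>p\<in>S \<times> S. of_bool (f j (fst p) = f j (snd p)))"
    using S by (simp add: E_def Int_def)
  also have "\<dots> = (\<Sum>p\<in>S \<times> S. \<Sum>j\<in>J. of_bool (f j (fst p) = f j (snd p)))"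
    by (rule sum.swap)
  also have "\<dots> = (\<Sum>p\<in>S \<times> S. card {j\<in>J. f j (fst p) = f j (snd p)})"
    using J by (simp add: Int_def)
  also have "\<dots> \<le> (\<Sum>p\<in>S \<times> S. q + of_bool (fst p = snd p) * card J)"
  proof (rule sum_mono)
    fix p assume p: "p \<in> S \<times> S"
    show "card {j\<in>J. f j (fst p) = f j (snd p)} \<le> q + of_bool (fst p = snd p) * card J"
      using p coin[of "fst p" "snd p"] by (cases "fst p = snd p") auto
  qed
  also have "\<dots> = q * s\<^sup>2 + s * card J"
  proof -
    have "{p \<in> S \<times> S. fst p = snd p} = (\<lambda>z. (z,z)) ` S" by auto
    then have "card {p \<in> S \<times> S. fst p = snd p} = s" by (simp add: s_def card_image inj_on_def)
    then have "(\<Sum>p\<in>S \<times> S. of_bool (fst p = snd p)) = s" using S by (simp add: Int_def)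
    then show ?thesis
      by (simp add: sum.distrib sum_distrib_right[symmetric] card_cartesian_product s_def power2_eq_square)
  qed
  finally have upper: "(\<Sum>j\<in>J. E j) \<le> q * s\<^sup>2 + s * card J" .
  have "card J * s\<^sup>2 \<le> m * (\<Sum>j\<in>J. E j)"
    using sum_mono[of J "\<lambda>_. s\<^sup>2" "\<lambda>j. m * E j"] lower by (simp add: sum_distrib_left)
  also have "\<dots> \<le> m * (q * s\<^sup>2 + s * card J)" using upper by (rule mult_le_mono2)
  finally have "s * (card J * s) \<le> s * (m * q * s + m * card J)"
    by (simp add: power2_eq_square algebra_simps)
  then have "card J * s \<le> m * q * s + m * card J" using m by (simp add: s_def)
  moreover have "2 * m * card J \<le> s * card J" using m(2) by (simp add: s_def)
  ultimately have "s * card J \<le> s * (2 * q * m)" by (simp only: ac_simps)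
  then show ?thesis using m by (simp add: s_def)
qed


section \<open>Minors, genericity and Cramer's rule\<close>

lemma submatrix_full_rows:
  assumes A: "A \<in> carrier_mat r n" and J: "J \<subseteq> {..<n}" "card J = r"
  shows "submatrix A {..<r} J = mat r r (\<lambda>(i,k). A $$ (i, pick J k))"
proof -
  have "{i. i < r \<and> i \<in> {..<r}} = {..<r}" and "{a. a < n \<and> a \<in> J} = J" using J by auto
  moreover have "pick {..<r} i = i" if "i < r" for i
  proof -
    have "{a \<in> {..<r}. a < i} = {..<i}" using that by auto
    then show ?thesis using pick_card_in_set[of i "{..<r}"] that by simp
  qed
  ultimately show ?thesis using A J(2) by (intro eq_matI) (auto simp: submatrix_def)
qed

text \<open>Members of \<open>minors\<close> list their columns in increasing order, whereas
  Cramer's rule puts a column at any position and may repeat one. A repetition makes the determinant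
  0, and sorting changes only its sign.\<close>

lemma abs_det_select_columns_le:
  fixes A :: "int mat"
  assumes A: "A \<in> carrier_mat r n" and rk: "int_rank A = r" and md: "modular_mat \<Delta> A"
    and f: "\<And>k. k < r \<Longrightarrow> f k < n"
  shows "\<bar>det (mat r r (\<lambda>(i,k). A $$ (i, f k)))\<bar> \<le> int \<Delta>"
proof (cases "inj_on f {..<r}")
  case False
  then obtain p q where pq: "p < r" "q < r" "p \<noteq> q" "f p = f q" by (auto simp: inj_on_def)
  have "det (mat r r (\<lambda>(i,k). A $$ (i, f k))) = 0"
    using pq by (intro det_identical_columns[of _ r p q]) auto
  then show ?thesis by simp
next
  case True
  define J where "J = f ` {..<r}"
  have J: "J \<subseteq> {..<n}" "card J = r" "finite J"
    using f True by (auto simp: J_def card_image)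
  \<comment> \<open>\<open>\<pi> k\<close> is the position of \<open>f k\<close> in the increasing
    enumeration of \<open>J\<close>; it is the identity from \<open>r\<close> on, as
    \<open>permutes\<close> demands.\<close>
  define \<pi> where "\<pi> k = (if k < r then card {a \<in> J. a < f k} else k)" for k
  have f_J: "f k \<in> J" if "k < r" for k using that by (auto simp: J_def)
  have lt: "\<pi> k < r" if "k < r" for k
  proof -
    have "{a \<in> J. a < f k} \<subset> J" using f_J[OF that] by auto
    then show ?thesis using J(2,3) that by (metis \<pi>_def psubset_card_mono)
  qed
  have pick_pi: "pick J (\<pi> k) = f k" if "k < r" for k
    using pick_card_in_set[OF f_J[OF that]] that by (simp add: \<pi>_def)
  have "inj_on \<pi> {0..<r}"
    using pick_pi True by (auto intro!: inj_onI dest: inj_onD) (metis inj_onD lessThan_iff)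
  moreover have "\<pi> ` {0..<r} \<subseteq> {0..<r}" using lt by auto
  ultimately have "bij_betw \<pi> {0..<r} {0..<r}"
    by (simp add: bij_betw_def endo_inj_surj)
  then have \<pi>: "\<pi> permutes {0..<r}" by (rule bij_imp_permutes) (simp add: \<pi>_def)
  define B where "B = submatrix A {..<r} J"
  have B: "B \<in> carrier_mat r r" using submatrix_full_rows[OF A J(1,2)] by (simp add: B_def)
  have B_entry: "B $$ (i,k) = A $$ (i, pick J k)" if "i < r" "k < r" for i k
    using that submatrix_full_rows[OF A J(1,2)] by (simp add: B_def)
  have "det (mat r r (\<lambda>(i,k). A $$ (i, f k))) = det (transpose_mat (mat r r (\<lambda>(i,k). A $$ (i, f k))))"
    by (rule det_transpose[of _ r, symmetric]) simp
  also have "transpose_mat (mat r r (\<lambda>(i,k). A $$ (i, f k))) = mat r r (\<lambda>(k,i). transpose_mat B $$ (\<pi> k, i))"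
    using B lt B_entry pick_pi by (intro eq_matI) auto
  also have "det \<dots> = signof \<pi> * det (transpose_mat B)"
    using B by (intro det_permute_rows[OF _ \<pi>]) simp
  finally have "\<bar>det (mat r r (\<lambda>(i,k). A $$ (i, f k)))\<bar> = \<bar>det B\<bar>"
    using det_transpose[OF B] by (simp add: abs_mult sign_def)
  moreover have "det B \<in> minors r A" using A J unfolding minors_def B_def by force
  ultimately show ?thesis using md unfolding modular_mat_def rk by auto
qed

text \<open>Otherwise \<open>r\<close> such columns would form a square submatrix whose transpose
  annihilates \<open>y\<close>, hence a vanishing minor, which genericity excludes.\<close>

lemma card_orthogonal_columns_less:
  fixes A :: "int mat"
  assumes A: "A \<in> carrier_mat r n" and rk: "int_rank A = r" and gen: "generic_mat A"
    and y: "y \<in> carrier_vec r" "y \<noteq> 0\<^sub>v r"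
  shows "card {j\<in>{..<n}. col A j \<bullet> y = 0} < r"
proof (rule ccontr)
  assume "\<not> ?thesis"
  then have "r \<le> card {j\<in>{..<n}. col A j \<bullet> y = 0}" by (rule leI)
  then obtain J where J_orth: "J \<subseteq> {j\<in>{..<n}. col A j \<bullet> y = 0}" and card_J: "card J = r"
    by (rule obtain_subset_with_card_n) blast
  have J: "J \<subseteq> {..<n}" "card J = r" using J_orth card_J by auto
  define B where "B = submatrix A {..<r} J"
  have pick_J: "pick J k \<in> J" if "k < r" for k using that J by (intro pick_in_set_le) simp
  have B: "B \<in> carrier_mat r r" using submatrix_full_rows[OF A J(1,2)] by (simp add: B_def)
  have "col B k = col A (pick J k)" if "k < r" for k
    using A that submatrix_full_rows[OF A J] pick_J[OF that] J(1)
    by (intro eq_vecI) (auto simp: B_def)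
  then have "col B k \<bullet> y = 0" if "k < r" for k using pick_J[OF that] J_orth that by auto
  then have "transpose_mat B *\<^sub>v y = 0\<^sub>v r"
    using B by (intro eq_vecI) auto
  moreover have "transpose_mat B \<in> carrier_mat r r" using B by simp
  ultimately have "det (transpose_mat B) = 0" using det_0_iff_vec_prod_zero y by blast
  then have "det B = 0" using det_transpose[OF B] by simp
  moreover have "det B \<in> minors r A" using A J unfolding minors_def B_def by force
  ultimately show False using gen unfolding generic_mat_def rk by auto
qed

text \<open>Cramer's rule in division-free form: expansion along the replaced column uses only
  cofactors that delete this column, so they agree with those of \<open>B\<close>.\<close>

lemma adj_mat_mult_vec_index:
  assumes B: "B \<in> carrier_mat n n" and x: "x \<in> carrier_vec n" and k: "k < n"
  shows "(adj_mat B *\<^sub>v x) $ k = det (replace_col B x k)"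
proof -
  let ?R = "replace_col B x k"
  have R: "?R \<in> carrier_mat n n" using B by (auto simp: replace_col_def)
  have "det ?R = (\<Sum>i<n. ?R $$ (i,k) * cofactor ?R i k)"
    by (rule laplace_expansion_column[OF R k])
  also have "\<dots> = (\<Sum>i<n. x $ i * cofactor B i k)"
  proof (rule sum.cong[OF refl])
    fix i assume "i \<in> {..<n}"
    moreover have "mat_delete ?R i k = mat_delete B i k"
      using B by (intro eq_matI) (auto simp: mat_delete_def replace_col_def)
    ultimately show "?R $$ (i,k) * cofactor ?R i k = x $ i * cofactor B i k"
      using B k by (simp add: cofactor_def replace_col_def)
  qed
  also have "\<dots> = (adj_mat B *\<^sub>v x) $ k"
    using B x k by (simp add: adj_mat_def scalar_prod_def atLeast0LessThan mult.commute)
  finally show ?thesis by simp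
qed

section \<open>Counting with the lattice points of a box\<close>

text \<open>The subtracted sum is the minimum of the form on the box, reached with
  \<open>z k = T\<close> where \<open>m k\<close> is negative and \<open>z k = 0\<close> elsewhere.
  Above it, each coordinate adds at most \<open>T * d\<close>.\<close>

lemma linear_form_on_box_range:
  fixes m z :: "nat \<Rightarrow> int"
  assumes m: "\<And>k. k < r \<Longrightarrow> \<bar>m k\<bar> \<le> int d" and z: "\<And>k. k < r \<Longrightarrow> z k \<in> {0..int T}"
  shows "(\<Sum>k<r. z k * m k) - (\<Sum>k<r. min 0 (m k) * int T) \<in> {0..int (r * T * d)}"
proof -
  have summand: "0 \<le> z k * m k - min 0 (m k) * int T \<and> z k * m k - min 0 (m k) * int T \<le> int T * int d"
    if k: "k < r" for k
  proof (cases "m k \<ge> 0")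
    case True
    have "z k * m k \<le> int T * int d" using z[OF k] m[OF k] True by (intro mult_mono) auto
    moreover have "0 \<le> z k * m k" using z[OF k] True by simp
    ultimately show ?thesis using True by simp
  next
    case False
    have "z k * m k - min 0 (m k) * int T = (int T - z k) * (- m k)"
      using False by (simp add: min_def algebra_simps)
    moreover have "(int T - z k) * (- m k) \<le> int T * int d"
      using z[OF k] m[OF k] False by (intro mult_mono) auto
    moreover have "0 \<le> (int T - z k) * (- m k)"
      using z[OF k] False by (intro mult_nonneg_nonneg) auto
    ultimately show ?thesis by metis
  qed
  have "0 \<le> (\<Sum>k<r. z k * m k - min 0 (m k) * int T)"
    using summand by (intro sum_nonneg) blast
  moreover have "(\<Sum>k<r. z k * m k - min 0 (m k) * int T) \<le> of_nat (card {..<r}) * (int T * int d)"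
    using summand by (intro sum_bounded_above) blast
  ultimately show ?thesis by (simp add: sum_subtractf mult.assoc)
qed

text \<open>The hypothesis on \<open>T\<close> makes the box so large that one of the at most
  \<open>\<Delta>\<close> cosets of the lattice of \<open>transpose_mat B\<close> contains
  \<open>2 * (r * T + 1)\<close> of its points. Then \<open>card_le_of_few_coincidences\<close>
  applies with \<open>m = r * T + 1\<close> and \<open>q = r\<close>.\<close>

lemma generic_modular_column_bound:
  fixes A :: "int mat"
  assumes A: "A \<in> carrier_mat r n" and rk: "int_rank A = r"
    and gen: "generic_mat A" and md: "modular_mat \<Delta> A" and \<Delta>: "\<Delta> > 0"
    and T: "2 * (r * T + 1) * \<Delta> \<le> (T + 1) ^ r"
  shows "n \<le> 2 * r * (r * T + 1)"
proof -
  obtain I J where IJ: "I \<subseteq> {..<r}" "J \<subseteq> {..<n}" "card I = r" "card J = r"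
    and abs_minor: "\<bar>det (submatrix A I J)\<bar> = int \<Delta>"
    using md A unfolding modular_mat_def rk minors_def by auto
  have I: "I = {..<r}" using IJ card_subset_eq[of "{..<r}" I] by auto
  have pick_J: "pick J k < n" if "k < r" for k
    using that IJ pick_in_set_le[of k J] by auto
  define B where "B = mat r r (\<lambda>(i,k). A $$ (i, pick J k))"
  have B: "B \<in> carrier_mat r r" by (simp add: B_def)
  have "submatrix A I J = B"
    unfolding I B_def by (rule submatrix_full_rows[OF A IJ(2,4)])
  then have det_B: "\<bar>det B\<bar> = int \<Delta>" using abs_minor by simp
  \<comment> \<open>\<open>\<mu> j\<close> is the coordinate vector of column \<open>j\<close> in the basis \<open>B\<close>, scaled by \<open>det B\<close> to be integral.\<close>
  define \<mu> where "\<mu> j = adj_mat B *\<^sub>v col A j" for j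
  have col: "col A j \<in> carrier_vec r" if "j < n" for j using A that by auto
  have \<mu>: "\<mu> j \<in> carrier_vec r" for j
    using adj_mat(1)[OF B] by (intro carrier_vecI) (simp add: \<mu>_def)
  have B_\<mu>: "B *\<^sub>v \<mu> j = det B \<cdot>\<^sub>v col A j" if "j < n" for j
  proof -
    have "B *\<^sub>v \<mu> j = (B * adj_mat B) *\<^sub>v col A j"
      unfolding \<mu>_def using B adj_mat(1)[OF B] col[OF that] by simp
    also have "\<dots> = det B \<cdot>\<^sub>v (1\<^sub>m r *\<^sub>v col A j)"
      unfolding adj_mat(2)[OF B] using col[OF that] by (simp add: smult_one_mult_mat_vec)
    finally show ?thesis using col[OF that] by simp
  qed
  have \<mu>_le: "\<bar>\<mu> j $ k\<bar> \<le> int \<Delta>" if j: "j < n" and k: "k < r" for j k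
  proof -
    have "\<mu> j $ k = det (replace_col B (col A j) k)"
      unfolding \<mu>_def by (rule adj_mat_mult_vec_index[OF B col[OF j] k])
    also have "replace_col B (col A j) k = mat r r (\<lambda>(i,l). A $$ (i, if l = k then j else pick J l))"
      using A j by (intro eq_matI) (auto simp: replace_col_def B_def)
    finally show ?thesis
      using abs_det_select_columns_le[OF A rk md, of "\<lambda>l. if l = k then j else pick J l"] j pick_J by auto
  qed
  have BT: "transpose_mat B \<in> carrier_mat r r" using B by simp
  have "det (transpose_mat B) \<noteq> 0" using det_transpose[OF B] det_B \<Delta> by auto
  from det_lattice_reduction[OF BT this] obtain h where
    prod_h: "int (\<Prod>k<r. h k) \<le> \<bar>det (transpose_mat B)\<bar>"
    and red: "\<And>z. z \<in> carrier_vec r \<Longrightarrow>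
      \<exists>y\<in>carrier_vec r. \<forall>k<r. (z - transpose_mat B *\<^sub>v y) $ k \<in> {0..<int (h k)}"
    by blast
  then have "\<forall>z\<in>carrier_vec r. \<exists>y. y \<in> carrier_vec r \<and>
      (\<forall>k<r. (z - transpose_mat B *\<^sub>v y) $ k \<in> {0..<int (h k)})"
    by blast
  from bchoice[OF this] obtain y where y: "\<And>z. z \<in> carrier_vec r \<Longrightarrow> y z \<in> carrier_vec r"
    "\<And>z k. z \<in> carrier_vec r \<Longrightarrow> k < r \<Longrightarrow> (z - transpose_mat B *\<^sub>v y z) $ k \<in> {0..<int (h k)}"
    by blast
  define Box where "Box = {..<r} \<rightarrow>\<^sub>E {0..int T}"
  define R where "R = (\<Pi>\<^sub>E k\<in>{..<r}. {0..<int (h k)})"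
  \<comment> \<open>\<open>\<phi> z\<close> is a reduced representative of the coset of
    \<open>z\<close>, so each fibre of \<open>\<phi>\<close> lies in a single coset.\<close>
  define \<phi> where "\<phi> z = (\<lambda>k\<in>{..<r}. (vec r z - transpose_mat B *\<^sub>v y (vec r z)) $ k)" for z
  have fin: "finite Box" "finite R" by (auto simp: Box_def R_def intro!: finite_PiE)
  have card_Box: "card Box = (T + 1) ^ r" by (simp add: Box_def card_PiE add.commute nat_add_distrib)
  have "(\<Prod>k<r. h k) \<le> \<Delta>"
    using prod_h unfolding det_transpose[OF B] det_B by (simp only: of_nat_le_iff)
  then have card_R: "card R \<le> \<Delta>" by (simp add: R_def card_PiE)
  have \<phi>R: "\<phi> \<in> Box \<rightarrow> R" using y(2)[OF vec_carrier] by (auto simp: \<phi>_def R_def)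
  have Box_ne: "Box \<noteq> {}" using card_Box by force
  then have "R \<noteq> {}" using \<phi>R by auto
  then obtain w where w: "w \<in> R" and fiber: "card Box \<le> card (\<phi> -` {w} \<inter> Box) * card R"
    using pigeonhole_card[OF \<phi>R fin] by blast
  define S where "S = \<phi> -` {w} \<inter> Box"
  have finS: "finite S" using fin by (simp add: S_def)
  have "2 * (r * T + 1) * \<Delta> \<le> card S * \<Delta>"
    using T fiber[folded S_def] mult_le_mono2[OF card_R, of "card S"] unfolding card_Box by linarith
  then have card_S: "2 * (r * T + 1) \<le> card S"
    using \<Delta> by (rule mult_right_le_imp_le)
  have diff: "\<exists>x\<in>carrier_vec r. vec r z - vec r z' = transpose_mat B *\<^sub>v x" if "z \<in> S" "z' \<in> S" for z z'
  proof -
    let ?u = "y (vec r z)" and ?u' = "y (vec r z')"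
    have u: "?u \<in> carrier_vec r" "?u' \<in> carrier_vec r" using y(1) by auto
    define a where "a = transpose_mat B *\<^sub>v ?u"
    define a' where "a' = transpose_mat B *\<^sub>v ?u'"
    have a: "a \<in> carrier_vec r" "a' \<in> carrier_vec r"
      unfolding a_def a'_def using BT u by (auto intro: mult_mat_vec_carrier)
    have "(vec r z - a) $ k = (vec r z' - a') $ k" if "k < r" for k
    proof -
      have "\<phi> z = \<phi> z'" using \<open>z \<in> S\<close> \<open>z' \<in> S\<close> by (simp add: S_def)
      from fun_cong[OF this, of k] show ?thesis using that unfolding \<phi>_def a_def a'_def by simp
    qed
    then have e: "z k - a $ k = z' k - a' $ k" if "k < r" for k using that a by simp
    have "vec r z - vec r z' = a - a'"
    proof (rule eq_vecI)
      fix k assume "k < dim_vec (a - a')"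
      then have "k < r" using a by simp
      then show "(vec r z - vec r z') $ k = (a - a') $ k" using e[of k] a by simp
    qed (use a in simp)
    also have "\<dots> = transpose_mat B *\<^sub>v (?u - ?u')"
      unfolding a_def a'_def using mult_minus_distrib_mat_vec[OF BT u] by (rule sym)
    finally show ?thesis using u by (intro bexI[of _ "?u - ?u'"]) auto
  qed
  \<comment> \<open>\<open>f j\<close> pairs \<open>z\<close> with the coordinates of column
    \<open>j\<close>, scaled by \<open>det B\<close>; integer differences before scaling become
    multiples of \<open>det B\<close>.\<close>
  define f where "f j z = (\<Sum>k<r. z k * \<mu> j $ k)" for j and z :: "nat \<Rightarrow> int"
  have f_diff: "f j z - f j z' = det B * (col A j \<bullet> x)"
    if j: "j < n" and x: "x \<in> carrier_vec r" "vec r z - vec r z' = transpose_mat B *\<^sub>v x" for j x z z'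
  proof -
    have "f j z - f j z' = (\<Sum>k<r. (z k - z' k) * \<mu> j $ k)"
      by (simp add: f_def left_diff_distrib sum_subtractf)
    also have "\<dots> = (vec r z - vec r z') \<bullet> \<mu> j"
      using \<mu>[of j] by (simp add: scalar_prod_def atLeast0LessThan)
    also have "\<dots> = x \<bullet> (B *\<^sub>v \<mu> j)"
      unfolding x(2) by (rule transpose_vec_mult_scalar[OF B \<mu> x(1)])
    also have "\<dots> = det B * (x \<bullet> col A j)" unfolding B_\<mu>[OF j] using x(1) col[OF j] by simp
    also have "x \<bullet> col A j = col A j \<bullet> x" using x(1) col[OF j] by (rule comm_scalar_prod)
    finally show ?thesis .
  qed
  have "card {..<n} \<le> 2 * r * (r * T + 1)"
  proof (rule card_le_of_few_coincidences[where S = S and f = f])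
    show "2 * (r * T + 1) \<le> card S" by (rule card_S)
  next
    fix z z' assume z: "z \<in> S" "z' \<in> S" "z \<noteq> z'"
    obtain x where x: "x \<in> carrier_vec r" "vec r z - vec r z' = transpose_mat B *\<^sub>v x"
      using diff[OF z(1,2)] by blast
    have "x \<noteq> 0\<^sub>v r"
    proof
      assume "x = 0\<^sub>v r"
      moreover have "transpose_mat B *\<^sub>v 0\<^sub>v r = 0\<^sub>v r" using B by (intro eq_vecI) auto
      ultimately have "vec r z - vec r z' = 0\<^sub>v r" using x(2) by simp
      then have eq: "(vec r z - vec r z') $ k = 0\<^sub>v r $ k" for k by simp
      have "z k = z' k" if "k < r" for k using eq[of k] that by simp
      \<comment> \<open>Points of \<open>Box\<close> are extensional, so agreement below
        \<open>r\<close> suffices.\<close>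
      then have "z = z'" using z(1,2) by (intro PiE_ext[of z "{..<r}" "\<lambda>_. {0..int T}"]) (auto simp: S_def Box_def)
      then show False using z(3) by simp
    qed
    then have "card {j\<in>{..<n}. col A j \<bullet> x = 0} < r"
      using card_orthogonal_columns_less[OF A rk gen x(1)] by simp
    moreover have "f j z = f j z' \<longleftrightarrow> col A j \<bullet> x = 0" if "j < n" for j
      using f_diff[OF that x] det_B \<Delta> by (metis abs_eq_0 eq_iff_diff_eq_0 mult_eq_0_iff not_less_iff_gr_or_eq of_nat_0_eq_iff)
    then have "{j\<in>{..<n}. f j z = f j z'} = {j\<in>{..<n}. col A j \<bullet> x = 0}" by auto
    ultimately show "card {j\<in>{..<n}. f j z = f j z'} \<le> r" by simp
  next
    fix j assume "j \<in> {..<n}"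
    then have j: "j < n" by simp
    define lo where "lo = (\<Sum>k<r. min 0 (\<mu> j $ k) * int T)"
    have range: "f j z - lo \<in> {0..int (r * T * \<Delta>)}" if "z \<in> S" for z
    proof -
      have "z \<in> Box" using that by (simp add: S_def)
      then have box: "z k \<in> {0..int T}" if "k < r" for k
        using that PiE_mem[of z "{..<r}" "\<lambda>_. {0..int T}" k] by (simp only: Box_def lessThan_iff)
      show ?thesis
        unfolding f_def lo_def by (rule linear_form_on_box_range[OF \<mu>_le[OF j] box])
    qed
    \<comment> \<open>The values of \<open>f j\<close> on \<open>S\<close> are congruent modulo
      \<open>\<Delta>\<close> and, shifted by \<open>lo\<close>, lie between 0 and
      \<open>r * T * \<Delta>\<close>. The quotient by \<open>\<Delta>\<close> therefore separates
      them and takes at most \<open>r * T + 1\<close> values.\<close>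
    have "inj_on (\<lambda>v. (v - lo) div int \<Delta>) (f j ` S)"
    proof (rule inj_onI)
      fix v v' assume "v \<in> f j ` S" "v' \<in> f j ` S" and q: "(v - lo) div int \<Delta> = (v' - lo) div int \<Delta>"
      then obtain z z' where z: "z \<in> S" "z' \<in> S" and v: "v = f j z" "v' = f j z'" by blast
      obtain x where x: "x \<in> carrier_vec r" "vec r z - vec r z' = transpose_mat B *\<^sub>v x"
        using diff[OF z] by blast
      have "(v - lo) - (v' - lo) = det B * (col A j \<bullet> x)"
        unfolding v f_diff[OF j x, symmetric] by linarith
      then have "int \<Delta> dvd (v - lo) - (v' - lo)" unfolding det_B[symmetric] by simp
      then have m: "(v - lo) mod int \<Delta> = (v' - lo) mod int \<Delta>" unfolding mod_eq_dvd_iff .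
      have "v - lo = (v - lo) div int \<Delta> * int \<Delta> + (v - lo) mod int \<Delta>"
        by (rule div_mult_mod_eq[symmetric])
      also have "\<dots> = v' - lo" unfolding q m by (rule div_mult_mod_eq)
      finally show "v = v'" by linarith
    qed
    moreover have "(\<lambda>v. (v - lo) div int \<Delta>) ` (f j ` S) \<subseteq> {0..int (r * T)}"
    proof clarify
      fix z assume "z \<in> S"
      then have b: "0 \<le> f j z - lo" "f j z - lo \<le> int (r * T * \<Delta>)" using range by auto
      have "(f j z - lo) div int \<Delta> \<le> int (r * T * \<Delta>) div int \<Delta>"
        using b \<Delta> by (intro zdiv_mono1) auto
      also have "\<dots> = int (r * T)" using \<Delta> by simp
      finally show "(f j z - lo) div int \<Delta> \<in> {0..int (r * T)}"
        using b \<Delta> by (simp add: pos_imp_zdiv_nonneg_iff)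
    qed
    ultimately have "card (f j ` S) \<le> card {0..int (r * T)}" by (intro card_inj_on_le) auto
    then show "card (f j ` S) \<le> r * T + 1" by (simp add: nat_add_distrib add.commute nat_mult_distrib)
  qed (use finS in auto)
  then show ?thesis by simp
qed

section \<open>Choice of the box size\<close>

theorem theorem1p4:
  fixes \<Delta> r :: nat
  assumes "\<Delta> > 0" and "r > 0" and "r \<ge> 3"
  shows "real (g \<Delta> r) \<le> 130 * real r ^ 3 * real \<Delta> powr (2 / real r)"
proof -
  have "g \<Delta> r \<in> generic_sizes \<Delta> r"
    unfolding g_def using assms by (intro Max_in generic_sizes_finite generic_sizes_nonempty)
  then obtain A where A: "A \<in> carrier_mat r (g \<Delta> r)" "int_rank A = r" "generic_mat A" "modular_mat \<Delta> A"
    by (auto simp: generic_sizes_def)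
  define p where "p = real \<Delta> powr (2 / real r)"
  define T where "T = nat \<lfloor>2 * real r * p\<rfloor>"
  have p1: "1 \<le> p" using assms by (simp add: p_def ge_one_powr_ge_zero)
  have T_le: "real T \<le> 2 * real r * p" using p1 by (simp add: T_def)
  have T_ge: "2 * real r * p \<le> real (T + 1)" unfolding T_def by linarith
  have "real \<Delta> = real \<Delta> powr 1" using assms by simp
  \<comment> \<open>The exponent \<open>2 / r * (r - 1)\<close> is at least 1 because
    \<open>r\<close> is at least 2.\<close>
  also have "\<dots> \<le> real \<Delta> powr (2 / real r * real (r - 1))"
    using assms by (intro powr_mono) (auto simp: field_simps of_nat_diff)
  also have "\<dots> = p ^ (r - 1)"
    using assms by (simp add: p_def powr_power mult.commute)
  finally have \<Delta>_le: "real \<Delta> \<le> p ^ (r - 1)" .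
  \<comment> \<open>As \<open>r * T + 1\<close> is at most \<open>r * (T + 1)\<close>, the condition
    on \<open>T\<close> follows from \<open>2 * r * \<Delta> \<le> (T + 1) ^ (r - 1)\<close>. The
    factor \<open>2 * r\<close> in \<open>T\<close> pays for the \<open>2 * r\<close> here, and
    \<open>p\<close> pays for \<open>\<Delta>\<close>.\<close>
  have "2 * real r * real \<Delta> \<le> (2 * real r) ^ (r - 1) * p ^ (r - 1)"
    using assms \<Delta>_le self_le_power[of "2 * real r" "r - 1"] by (intro mult_mono) auto
  also have "\<dots> \<le> real (T + 1) ^ (r - 1)"
    unfolding power_mult_distrib[symmetric] using T_ge p1 by (intro power_mono) auto
  finally have "2 * r * \<Delta> \<le> (T + 1) ^ (r - 1)"
    by (metis (no_types, lifting) of_nat_le_iff of_nat_mult of_nat_numeral of_nat_power)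
  then have "(T + 1) * (2 * r * \<Delta>) \<le> (T + 1) * (T + 1) ^ (r - 1)" by (rule mult_le_mono2)
  also have "\<dots> = (T + 1) ^ r" using assms by (simp add: power_eq_if)
  finally have "(T + 1) * (2 * r * \<Delta>) \<le> (T + 1) ^ r" .
  moreover have "2 * (r * T + 1) * \<Delta> \<le> 2 * (r * T + r) * \<Delta>" using assms by (intro mult_le_mono) auto
  moreover have "2 * (r * T + r) * \<Delta> = (T + 1) * (2 * r * \<Delta>)" by (simp add: algebra_simps)
  ultimately have "2 * (r * T + 1) * \<Delta> \<le> (T + 1) ^ r" by linarith
  then have "g \<Delta> r \<le> 2 * r * (r * T + 1)"
    using A assms by (intro generic_modular_column_bound) auto
  then have "real (g \<Delta> r) \<le> real (2 * r * (r * T + 1))" by (rule of_nat_mono)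
  also have "\<dots> = 2 * real r * (real r * real T + 1)" by (simp add: algebra_simps)
  \<comment> \<open>The summand 1 is absorbed into \<open>r * r * p\<close>, so that everything
    becomes a multiple of \<open>r ^ 3 * p\<close>.\<close>
  also have "\<dots> \<le> 2 * real r * (real r * (2 * real r * p) + real r * real r * p)"
  proof -
    have "1 * 1 * 1 \<le> real r * real r * p" using assms p1 by (intro mult_mono) auto
    then show ?thesis using T_le assms by (intro mult_left_mono add_mono) auto
  qed
  also have "\<dots> = 6 * (real r ^ 3 * p)" by (simp add: power3_eq_cube algebra_simps)
  also have "\<dots> \<le> 130 * (real r ^ 3 * p)" using p1 by (intro mult_right_mono) auto
  finally show ?thesis by (simp add: p_def mult.assoc)
qed

end
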